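(* $T_2(6)=11$; that is, every triangle-free graph on $11$ vertices contains a $2$-sparse set of $6$ vertices, and there is a triangle-free graph on $10$ vertices containing no $2$-sparse set of $6$ vertices.
   Context: All graphs are finite and simple. A set $S$ of vertices of a graph $G$ is $k$-sparse if the induced subgraph $G[S]$ has maximum degree at most $k$. For integers $k\ge0$ and $j\ge1$, $T_k(j)$ denotes the minimum $n$ such that every triangle-free graph on $n$ vertices contains a $k$-sparse set of $j$ vertices. *)

theory Defs
  imports "Graph_Theory.Digraph_Component"
begin

(* A finite simple graph is a pair_graph: a finite, loop-free, symmetric digraph without parallel
   arcs, each undirected edge uv being represented by the two arcs (u, v) and (v, u).
   In particular the degree of a vertex is its out-degree. *)

(* There are no loops, so u, v, w below are automatically distinct. *)
definition triangle_free :: "'a pair_pre_digraph \<Rightarrow> bool" where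
  "triangle_free G \<longleftrightarrow>
     \<not> (\<exists>u v w. (u, v) \<in> parcs G \<and> (v, w) \<in> parcs G \<and> (w, u) \<in> parcs G)"

definition sparse_set :: "nat \<Rightarrow> 'a pair_pre_digraph \<Rightarrow> 'a set \<Rightarrow> bool" where
  "sparse_set k G S \<longleftrightarrow>
     S \<subseteq> pverts G \<and> (\<forall>v \<in> S. out_degree (with_proj G \<restriction> S) v \<le> k)"

(* T_k(j). All the notions involved are invariant under isomorphism, so it suffices to let the
   graphs range over those whose vertices are natural numbers. *)
definition T :: "nat \<Rightarrow> nat \<Rightarrow> nat" where
  "T k j = (LEAST n. \<forall>G :: nat pair_pre_digraph.
     pair_graph G \<and> card (pverts G) = n \<and> triangle_free G \<longrightarrow>
       (\<exists>S. sparse_set k G S \<and> card S = j))"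

end

theory Submission
  imports Defs
begin

text \<open>Upper bound: if some vertex has degree at least \<open>6\<close>, its neighbourhood is independent. Otherwise
  all degrees are at most \<open>5\<close>, and in a bipartition of the vertices with as few monochromatic edges
  as possible every vertex has at most half of its neighbours, hence at most \<open>2\<close>, on its own side;
  any \<open>6\<close> vertices of the larger side form a sparse set. Lower bound: the complete bipartite graph
  with two parts of size \<open>5\<close>.\<close>

lemma out_degree_induced:
  assumes "v \<in> S"
  shows "out_degree (with_proj G \<restriction> S) v = card {w \<in> S. (v, w) \<in> parcs G}"
proof -
  have "out_arcs (with_proj G \<restriction> S) v = Pair v ` {w \<in> S. (v, w) \<in> parcs G}"
    using assms by (auto simp: out_arcs_def)
  then show ?thesis
    by (simp add: out_degree_def card_image inj_on_def)
qed

lemma sparse_set_iff: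
  "sparse_set k G S \<longleftrightarrow>
     S \<subseteq> pverts G \<and> (\<forall>v \<in> S. card {w \<in> S. (v, w) \<in> parcs G} \<le> k)"
  by (auto simp: sparse_set_def out_degree_induced)

lemma (in pair_graph) sparse_set_subset:
  assumes "sparse_set k G S" "S' \<subseteq> S"
  shows "sparse_set k G S'"
proof -
  have "finite S"
    using assms(1) finite_subset[OF _ pair_finite_verts] by (simp add: sparse_set_def)
  then have "card {w \<in> S'. (v, w) \<in> parcs G} \<le> card {w \<in> S. (v, w) \<in> parcs G}" for v
    using assms(2) by (intro card_mono) auto
  then show ?thesis
    using assms unfolding sparse_set_iff by (meson order_trans subset_iff)
qed

text \<open>Moving a single vertex across a bipartition exchanges its monochromatic and bichromatic
  edges and affects no others. At a minimum this cannot pay off, so at most half of at most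
  \<open>2 * k + 1\<close> neighbours, hence at most \<open>k\<close>, share its side.\<close>

lemma (in pair_graph) sparse_bipartition:
  assumes deg: "\<And>v. v \<in> pverts G \<Longrightarrow> card {w. (v, w) \<in> parcs G} \<le> 2 * k + 1"
  obtains A where "sparse_set k G A" "sparse_set k G (pverts G - A)"
proof -
  define mono_arcs where
    "mono_arcs A = {e \<in> parcs G. fst e \<in> A \<longleftrightarrow> snd e \<in> A}" for A
  have fin_mono: "finite (mono_arcs A)" for A
    using pair_finite_arcs by (simp add: mono_arcs_def)
  obtain A where A: "A \<subseteq> pverts G"
    and min: "\<And>B. B \<subseteq> pverts G \<Longrightarrow> card (mono_arcs A) \<le> card (mono_arcs B)"
    using ex_has_least_nat[of "\<lambda>A. A \<subseteq> pverts G" "{}" "\<lambda>A. card (mono_arcs A)"] by auto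
  \<comment> \<open>Comparing membership of \<open>w\<close> and \<open>v\<close> by an equivalence
    treats both sides at once.\<close>
  have own_side: "card {w. (v, w) \<in> parcs G \<and> (w \<in> A \<longleftrightarrow> v \<in> A)} \<le> k" if v: "v \<in> pverts G" for v
  proof -
    let ?same = "{w. (v, w) \<in> parcs G \<and> (w \<in> A \<longleftrightarrow> v \<in> A)}"
    let ?other = "{w. (v, w) \<in> parcs G \<and> (w \<in> A \<longleftrightarrow> v \<notin> A)}"
    \<comment> \<open>All pairs joining \<open>v\<close> to \<open>N\<close>, in both directions:
      each edge is two arcs, hence the factor 2 below. A loop at \<open>v\<close> would be counted
      only once, so \<open>v \<notin> N\<close> is required.\<close>
    define star where
      "star N = {e. fst e = v \<and> snd e \<in> N \<or> snd e = v \<and> fst e \<in> N}" for N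
    \<comment> \<open>The competitor to \<open>A\<close>: only \<open>v\<close> changes sides. The
      arcs in \<open>rest\<close> avoid \<open>v\<close> and so are monochromatic for both.\<close>
    define B where "B = (if v \<in> A then A - {v} else insert v A)"
    define rest where "rest = {e \<in> mono_arcs A. fst e \<noteq> v \<and> snd e \<noteq> v}"
    have loop: "(v, v) \<notin> parcs G"
      using no_loops' by blast
    have sym: "(w, v) \<in> parcs G \<longleftrightarrow> (v, w) \<in> parcs G" if "w \<noteq> v" for w
      using arcs_symmetric by blast
    have nbrs: "{w. (v, w) \<in> parcs G} \<subseteq> pverts G"
      using in_arcsD2 by blast
    have fin: "finite ?same" "finite ?other"
      by (rule finite_subset[OF _ finite_subset[OF nbrs pair_finite_verts]], blast)+
    have card_star: "finite (star N) \<and> card (star N) = 2 * card N"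
      if "finite N" "v \<notin> N" for N
    proof -
      have star_Un: "star N = Pair v ` N \<union> (\<lambda>w. (w, v)) ` N"
        by (auto simp: star_def)
      have "card (star N) = card (Pair v ` N) + card ((\<lambda>w. (w, v)) ` N)"
        unfolding star_Un using that by (intro card_Un_disjoint) auto
      with that(1) show ?thesis
        by (simp add: star_Un card_image inj_on_def)
    qed
    have card_rest: "card (rest \<union> star N) = card rest + 2 * card N"
      if "finite N" "v \<notin> N" for N
    proof -
      have "finite rest" "rest \<inter> star N = {}"
        using fin_mono by (auto simp: rest_def star_def)
      with card_star[OF that] show ?thesis
        by (simp add: card_Un_disjoint)
    qed
    have "e \<in> mono_arcs A \<longleftrightarrow> e \<in> rest \<union> star ?same"
      "e \<in> mono_arcs B \<longleftrightarrow> e \<in> rest \<union> star ?other" for e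
      by (cases e; cases "fst e = v"; cases "snd e = v";
          simp add: mono_arcs_def rest_def star_def B_def loop sym eq_commute)+
    then have "mono_arcs A = rest \<union> star ?same" "mono_arcs B = rest \<union> star ?other"
      by blast+
    then have "card (mono_arcs A) = card rest + 2 * card ?same"
      "card (mono_arcs B) = card rest + 2 * card ?other"
      using card_rest fin loop by simp_all
    moreover have "card (mono_arcs A) \<le> card (mono_arcs B)"
      using A v by (intro min) (auto simp: B_def)
    moreover have "{w. (v, w) \<in> parcs G} = ?same \<union> ?other" "?same \<inter> ?other = {}"
      by auto
    then have "card ?same + card ?other = card {w. (v, w) \<in> parcs G}"
      using fin by (simp only: card_Un_disjoint)
    \<comment> \<open>Minimality gives \<open>card ?same \<le> card ?other\<close>, and the two sum
      to at most \<open>2 * k + 1\<close>.\<close>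
    ultimately show ?thesis
      using deg[OF v] by simp
  qed
  have "card {w \<in> A. (v, w) \<in> parcs G} \<le> k" if "v \<in> A" for v
    using own_side[of v] A that by (simp add: subset_iff conj_commute)
  moreover have "card {w \<in> pverts G - A. (v, w) \<in> parcs G} \<le> k" if "v \<in> pverts G - A" for v
  proof -
    have "{w \<in> pverts G - A. (v, w) \<in> parcs G} = {w. (v, w) \<in> parcs G \<and> (w \<in> A \<longleftrightarrow> v \<in> A)}"
      using that by (auto dest: in_arcsD2)
    with own_side[of v] that show ?thesis
      by simp
  qed
  ultimately have "sparse_set k G A" "sparse_set k G (pverts G - A)"
    using A by (auto simp only: sparse_set_iff)
  then show thesis
    by (rule that)
qed

text \<open>The bound \<open>j \<le> 2 * k + 2\<close> turns degrees below \<open>j\<close> into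
  degrees at most \<open>2 * k + 1\<close>, as the bipartition demands;
  \<open>2 * j \<le> card (pverts G) + 1\<close> makes its larger side reach \<open>j\<close>. Both
  are equalities for \<open>k = 2\<close>, \<open>j = 6\<close> and 11 vertices.\<close>

lemma (in pair_graph) triangle_free_sparse_set:
  assumes "triangle_free G" "j \<le> 2 * k + 2" "2 * j \<le> card (pverts G) + 1"
  obtains S where "sparse_set k G S" "card S = j"
proof -
  have "\<exists>S. sparse_set k G S \<and> j \<le> card S"
  proof (cases "\<exists>v \<in> pverts G. j \<le> card {w. (v, w) \<in> parcs G}")
    case True
    then obtain v where v: "j \<le> card {w. (v, w) \<in> parcs G}"
      by blast
    \<comment> \<open>An edge between two neighbours of \<open>v\<close> would close a triangle, so
      all induced degrees in the neighbourhood are 0.\<close>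
    have indep: "(u, w) \<notin> parcs G" if "(v, u) \<in> parcs G" "(v, w) \<in> parcs G" for u w
      using assms(1) that arcs_symmetric unfolding triangle_free_def by blast
    have "sparse_set k G {w. (v, w) \<in> parcs G}"
      using indep in_arcsD2 by (auto simp: sparse_set_iff cong: conj_cong)
    with v show ?thesis
      by blast
  next
    case False
    with assms(2) have "card {w. (v, w) \<in> parcs G} \<le> 2 * k + 1" if "v \<in> pverts G" for v
      using that by (fastforce simp: not_le)
    then obtain A where A: "sparse_set k G A" "sparse_set k G (pverts G - A)"
      by (rule sparse_bipartition)
    then have "A \<subseteq> pverts G"
      by (simp add: sparse_set_def)
    then have "card A + card (pverts G - A) = card (pverts G)"
      using pair_finite_verts by (metis card_Diff_subset card_mono finite_subset le_add_diff_inverse)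
    with assms(3) have "j \<le> card A \<or> j \<le> card (pverts G - A)"
      by linarith
    with A show ?thesis
      by blast
  qed
  then obtain S where "sparse_set k G S" "j \<le> card S"
    by blast
  moreover from this obtain S' where "S' \<subseteq> S" "card S' = j"
    using obtain_subset_with_card_n by metis
  ultimately show thesis
    using that sparse_set_subset by blast
qed

text \<open>The balanced complete bipartite graph, with parity as the colouring; one formula serves
  every order, and order 10 gives parts of size 5.\<close>

definition parity_graph :: "nat \<Rightarrow> nat pair_pre_digraph" where
  "parity_graph n = \<lparr>pverts = {..<n}, parcs = {(u, v). u < n \<and> v < n \<and> even u \<noteq> even v}\<rparr>"

lemma pair_graph_parity_graph: "pair_graph (parity_graph n)"
proof
  have "finite ({..<n} \<times> {..<n})"
    by simp
  then show "finite (parcs (parity_graph n))"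
    by (rule rev_finite_subset) (auto simp: parity_graph_def)
qed (auto simp: parity_graph_def symmetric_def sym_def)

lemma triangle_free_parity_graph: "triangle_free (parity_graph n)"
  by (auto simp: triangle_free_def parity_graph_def)

text \<open>Each part has at most \<open>j - 1\<close> vertices, so a set of \<open>j\<close>
  vertices meets both. A vertex of one part is adjacent to all chosen vertices of the other, so
  sparsity would force \<open>j \<le> 2 * k\<close>.\<close>

lemma parity_graph_no_sparse_set:
  assumes "n + 2 \<le> 2 * j" "2 * k + 1 \<le> j" "sparse_set k (parity_graph n) S"
  shows "card S \<noteq> j"
proof
  assume card_S: "card S = j"
  have S: "S \<subseteq> {..<n}"
    and deg: "\<And>v. v \<in> S \<Longrightarrow> card {w \<in> S. (v, w) \<in> parcs (parity_graph n)} \<le> k"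
    using assms(3) by (auto simp: sparse_set_iff parity_graph_def)
  have fin: "finite S"
    using S finite_subset by blast
  let ?E = "{w \<in> S. even w}" and ?O = "{w \<in> S. odd w}"
  \<comment> \<open>Since \<open>n \<le> 2 * j - 2\<close>, halving an element of either parity
    class gives an index below \<open>j - 1\<close>.\<close>
  have "card ?E \<le> card ((\<lambda>i. 2 * i) ` {..<j - 1})"
    using S assms(1) by (intro card_mono) (auto elim!: evenE)
  also have "\<dots> \<le> j - 1"
    by (metis card_image_le card_lessThan finite_lessThan)
  finally have E: "card ?E \<le> j - 1" .
  have "card ?O \<le> card ((\<lambda>i. 2 * i + 1) ` {..<j - 1})"
    using S assms(1) by (intro card_mono) (auto elim!: oddE)
  also have "\<dots> \<le> j - 1"
    by (metis card_image_le card_lessThan finite_lessThan)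
  finally have O: "card ?O \<le> j - 1" .
  have sum: "card ?E + card ?O = j"
    using fin card_S by (subst card_Un_disjoint[symmetric]) (auto intro: arg_cong[where f = card])
  \<comment> \<open>The first assumption also yields \<open>j \<ge> 1\<close>, so
    \<open>j - 1\<close> is not truncated and neither class alone can account for
    \<open>j\<close>.\<close>
  then have "0 < card ?E" "0 < card ?O"
    using E O assms(1) by linarith+
  then obtain a b where a: "a \<in> S" "even a" and b: "b \<in> S" "odd b"
    by (auto simp: card_gt_0_iff)
  have "{w \<in> S. (a, w) \<in> parcs (parity_graph n)} = ?O"
    "{w \<in> S. (b, w) \<in> parcs (parity_graph n)} = ?E"
    using S a b by (auto simp: parity_graph_def)
  with deg[OF a(1)] deg[OF b(1)] sum assms(2) show False
    by simp
qed

theorem theorem3p5: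
  shows "T 2 6 = 11
    \<and> (\<forall>G :: 'a pair_pre_digraph.
         pair_graph G \<and> card (pverts G) = 11 \<and> triangle_free G \<longrightarrow>
           (\<exists>S. sparse_set 2 G S \<and> card S = 6))
    \<and> (\<exists>G :: nat pair_pre_digraph.
         pair_graph G \<and> card (pverts G) = 10 \<and> triangle_free G \<and>
           \<not> (\<exists>S. sparse_set 2 G S \<and> card S = 6))"
proof -
  \<comment> \<open>The fresh type \<open>'b\<close> is generalised: the bound is used over
    \<open>nat\<close> for \<open>T\<close> and over \<open>'a\<close> for the second
    conjunct.\<close>
  have upper: "\<exists>S. sparse_set 2 G S \<and> card S = 6"
    if "pair_graph G" "card (pverts G) = 11" "triangle_free G" for G :: "'b pair_pre_digraph"
    using pair_graph.triangle_free_sparse_set[of G 6 2] that by auto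
  \<comment> \<open>As \<open>T\<close> is a least \<open>n\<close>, every order up to 10 must be
    refuted, not only 10 itself.\<close>
  have lower: "\<exists>G :: nat pair_pre_digraph. pair_graph G \<and> card (pverts G) = n \<and> triangle_free G \<and>
      \<not> (\<exists>S. sparse_set 2 G S \<and> card S = 6)" if "n \<le> 10" for n
  proof -
    have "card (pverts (parity_graph n)) = n"
      by (simp add: parity_graph_def)
    then show ?thesis
      using pair_graph_parity_graph triangle_free_parity_graph
        parity_graph_no_sparse_set[of n 6 2] that by auto
  qed
  have "T 2 6 = 11"
    unfolding T_def
  proof (rule Least_equality)
    fix n
    assume "\<forall>G :: nat pair_pre_digraph. pair_graph G \<and> card (pverts G) = n \<and> triangle_free G \<longrightarrow>
      (\<exists>S. sparse_set 2 G S \<and> card S = 6)"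
    with lower[of n] show "11 \<le> n"
      by force
  qed (use upper in blast)
  with upper lower[of 10] show ?thesis
    by blast
qed

end
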